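(* Let $\mathcal{H}=(V,\mathcal{E})$ be a hypergraph in $\mathcal{L}_0$, i.e. every edge of $\mathcal{H}$ has even size, and for every cycle $C=(e_1,\ldots,e_r)$ of $\mathcal{H}$ there exist distinct vertices $u,v\in\bigcup_{1\le i\le r}e_i$ with $\{u,v\}\in\mathcal{E}$. Then $(-1)^{|V|}P(\mathcal{H},\lambda)>0$ for all real $\lambda\in(-\infty,0)$.
   Context: A hypergraph $\mathcal{H}=(V,\mathcal{E})$ consists of a finite vertex set $V$ and a set $\mathcal{E}$ of non-empty subsets of $V$ (edges). For a positive integer $k$, a weak proper $k$-coloring of $\mathcal{H}$ is a map $\phi:V\to\{1,\ldots,k\}$ such that $|\{\phi(v):v\in e\}|\ge 2$ for every $e\in\mathcal{E}$. The chromatic polynomial $P(\mathcal{H},\lambda)$ is the (unique) polynomial in $\lambda$ whose value at each positive integer $k$ is the number of weak proper $k$-colorings of $\mathcal{H}$. A cycle in $\mathcal{H}$ is a sequence $(v_1,e_1,v_2,e_2,\ldots,v_t,e_t,v_1)$ with $t\ge2$, where $v_1,\ldots,v_t$ are pairwise distinct vertices, $e_1,\ldots,e_t$ are pairwise distinct edges, and $\{v_i,v_{i+1}\}\subseteq e_i$ for $i=1,\ldots,t$ (with $v_{t+1}=v_1$); it is also written $(e_1,\ldots,e_t)$. *)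

theory Defs
  imports "HOL-Computational_Algebra.Polynomial" "HOL-Library.FuncSet"
begin

definition hypergraph :: "'a set \<Rightarrow> 'a set set \<Rightarrow> bool" where
  "hypergraph V E \<longleftrightarrow> finite V \<and> (\<forall>e\<in>E. e \<subseteq> V \<and> e \<noteq> {})"

(* Maps on V are extensional functions, so that each map V -> {1..k} is counted exactly once. *)
definition weak_proper_colorings :: "'a set \<Rightarrow> 'a set set \<Rightarrow> nat \<Rightarrow> ('a \<Rightarrow> nat) set" where
  "weak_proper_colorings V E k = {\<phi> \<in> V \<rightarrow>\<^sub>E {1..k}. \<forall>e\<in>E. card (\<phi> ` e) \<ge> 2}"

definition is_chromatic_poly :: "'a set \<Rightarrow> 'a set set \<Rightarrow> real poly \<Rightarrow> bool" where
  "is_chromatic_poly V E p \<longleftrightarrow>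
     (\<forall>k::nat. k \<ge> 1 \<longrightarrow> poly p (real k) = real (card (weak_proper_colorings V E k)))"

definition chromatic_poly :: "'a set \<Rightarrow> 'a set set \<Rightarrow> real poly" where
  "chromatic_poly V E = (THE p. is_chromatic_poly V E p)"

definition hyper_cycle :: "'a set \<Rightarrow> 'a set set \<Rightarrow> 'a list \<Rightarrow> 'a set list \<Rightarrow> bool" where
  "hyper_cycle V E vs es \<longleftrightarrow>
     length es \<ge> 2 \<and> length vs = length es \<and>
     distinct vs \<and> set vs \<subseteq> V \<and> distinct es \<and> set es \<subseteq> E \<and>
     (\<forall>i < length es. {vs ! i, vs ! (Suc i mod length vs)} \<subseteq> es ! i)"

definition in_L0 :: "'a set \<Rightarrow> 'a set set \<Rightarrow> bool" where
  "in_L0 V E \<longleftrightarrow>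
     (\<forall>e\<in>E. even (card e)) \<and>
     (\<forall>vs es. hyper_cycle V E vs es \<longrightarrow>
        (\<exists>u v. u \<noteq> v \<and> u \<in> \<Union>(set es) \<and> v \<in> \<Union>(set es) \<and> {u, v} \<in> E))"

text \<open>
  The chromatic polynomial is well defined. For existence, colorings are grouped by their image:
  the number of colorings with image \<open>S\<close> depends only on \<open>card S\<close>, so the number of colorings
  with \<open>k\<close> colors is a combination of the binomial coefficients \<open>k choose j\<close> with \<open>j \<le> card V\<close>.
\<close>

lemma is_chromatic_poly_unique:
  assumes "is_chromatic_poly V E p" "is_chromatic_poly V E q"
  shows "p = q"
proof (rule ccontr)
  assume "p \<noteq> q"
  then have "finite {x. poly (p - q) x = 0}"
    by (intro poly_roots_finite) simp
  moreover have "real ` {1..} \<subseteq> {x. poly (p - q) x = 0}"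
    using assms by (auto simp: is_chromatic_poly_def)
  ultimately have "finite (real ` {1..})"
    by (rule finite_subset[rotated])
  then show False
    by (simp add: finite_image_iff inj_on_def infinite_Ici)
qed

lemma binomial_poly_exists: "\<exists>p::real poly. \<forall>k::nat. poly p (real k) = real (k choose j)"
proof -
  define p :: "real poly" where "p = smult (1 / fact j) (\<Prod>i = 0..<j. [:- real i, 1:])"
  have "poly p (real k) = real (k choose j)" for k
    by (simp add: p_def poly_prod binomial_gbinomial gbinomial_prod_rev)
  then show ?thesis by blast
qed

lemma card_colorings_image_le:
  assumes "finite S" "finite T" "card S = card T" and EV: "\<And>e. e \<in> E \<Longrightarrow> e \<subseteq> V"
    and fin: "\<And>S::nat set. finite S \<Longrightarrow> finite (V \<rightarrow>\<^sub>E S)"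
  shows "card {\<phi> \<in> V \<rightarrow>\<^sub>E S. \<phi> ` V = S \<and> (\<forall>e\<in>E. card (\<phi> ` e) \<ge> 2)}
       \<le> card {\<phi> \<in> V \<rightarrow>\<^sub>E (T::nat set). \<phi> ` V = T \<and> (\<forall>e\<in>E. card (\<phi> ` e) \<ge> (2::nat))}"
    (is "card ?A \<le> card ?B")
proof -
  obtain h where h: "bij_betw h S T"
    using finite_same_card_bij[OF assms(1-3)] by blast
  let ?g = "\<lambda>\<phi>. restrict (h \<circ> \<phi>) V"
  have inj: "inj_on ?g ?A"
  proof (rule inj_onI)
    fix \<phi> \<psi> assume a: "\<phi> \<in> ?A" "\<psi> \<in> ?A" "?g \<phi> = ?g \<psi>"
    show "\<phi> = \<psi>"
    proof (rule PiE_ext)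
      show "\<phi> \<in> V \<rightarrow>\<^sub>E S" "\<psi> \<in> V \<rightarrow>\<^sub>E S" using a by auto
      fix x assume x: "x \<in> V"
      have "h (\<phi> x) = h (\<psi> x)" using fun_cong[OF a(3), of x] x by simp
      moreover have "\<phi> x \<in> S" "\<psi> x \<in> S" using a x by auto
      ultimately show "\<phi> x = \<psi> x" using h by (auto simp: bij_betw_def inj_on_def)
    qed
  qed
  have sub: "?g ` ?A \<subseteq> ?B"
  proof
    fix \<psi> assume "\<psi> \<in> ?g ` ?A"
    then obtain \<phi> where f: "\<phi> \<in> ?A" "\<psi> = ?g \<phi>" by blast
    have "\<psi> ` V = h ` \<phi> ` V" using f(2) by (auto simp: image_iff)
    also have "\<dots> = T" using f(1) h by (simp add: bij_betw_def)
    finally have im: "\<psi> ` V = T" .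
    have "card (\<psi> ` e) \<ge> 2" if e: "e \<in> E" for e
    proof -
      have "\<psi> ` e = h ` \<phi> ` e" using EV[OF e] f(2) by auto
      moreover have "inj_on h (\<phi> ` e)"
      proof (rule inj_on_subset)
        show "inj_on h S" using h by (auto simp: bij_betw_def)
        show "\<phi> ` e \<subseteq> S" using f(1) EV[OF e] by auto
      qed
      ultimately have "card (\<psi> ` e) = card (\<phi> ` e)" by (simp add: card_image)
      then show ?thesis using f(1) e by auto
    qed
    moreover have "\<psi> \<in> V \<rightarrow>\<^sub>E T"
      using im f(2) by auto
    ultimately show "\<psi> \<in> ?B" using im by auto
  qed
  have "finite ?B" using fin[OF assms(2)] by simp
  then show ?thesis using card_inj_on_le[OF inj sub] by simp
qed

lemma is_chromatic_poly_exists: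
  assumes "hypergraph V E"
  shows "\<exists>p. is_chromatic_poly V E p"
proof -
  have finV: "finite V" and EV: "\<And>e. e \<in> E \<Longrightarrow> e \<subseteq> V"
    using assms by (auto simp: hypergraph_def)
  have fin: "finite (V \<rightarrow>\<^sub>E S)" if "finite S" for S :: "nat set"
    using finV that by (intro finite_PiE) auto
  define A where "A S = {\<phi> \<in> V \<rightarrow>\<^sub>E S. \<phi> ` V = S \<and> (\<forall>e\<in>E. card (\<phi> ` e) \<ge> 2)}"
    for S :: "nat set"
  have cardA: "card (A S) = card (A {1..card S})" if "finite S" for S
    unfolding A_def using that EV fin
    by (intro antisym card_colorings_image_le) auto
  have finA: "finite (A S)" if "finite S" for S
    using fin[OF that] by (simp add: A_def)
  have A0: "card (A {1..j}) = 0" if "j > card V" for j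
  proof -
    have False if "\<phi> ` V = {1..j}" for \<phi>
      using card_image_le[OF finV, of \<phi>] that \<open>j > card V\<close> by simp
    then have "A {1..j} = {}" by (auto simp: A_def)
    then show ?thesis by simp
  qed
  obtain b :: "nat \<Rightarrow> real poly" where b: "\<And>j k. poly (b j) (real k) = real (k choose j)"
    using binomial_poly_exists by metis
  define p where "p = (\<Sum>j\<le>card V. smult (real (card (A {1..j}))) (b j))"
  have "poly p (real k) = real (card (weak_proper_colorings V E k))" for k
  proof -
    have "weak_proper_colorings V E k = (\<Union>S\<in>Pow {1..k}. A S)"
      by (auto simp: weak_proper_colorings_def A_def PiE_iff)
    moreover have "\<forall>S\<in>Pow {1..k}. finite (A S)"
      by (meson PowD finA finite_atLeastAtMost finite_subset)
    moreover have "\<forall>S\<in>Pow {1..k}. \<forall>T\<in>Pow {1..k}. S \<noteq> T \<longrightarrow> A S \<inter> A T = {}"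
      by (auto simp: A_def)
    ultimately have "card (weak_proper_colorings V E k) = (\<Sum>S\<in>Pow {1..k}. card (A S))"
      using card_UN_disjoint[of "Pow {1..k}" A] by simp
    also have "\<dots> = (\<Sum>S\<in>Pow {1..k}. card (A {1..card S}))"
      by (intro sum.cong refl cardA) (auto intro: finite_subset)
    also have "\<dots> = (\<Sum>j\<le>k. \<Sum>S\<in>{S \<in> Pow {1..k}. card S = j}. card (A {1..card S}))"
      by (intro sum.group [symmetric]) (auto dest: card_mono[rotated])
    also have "\<dots> = (\<Sum>j\<le>k. (k choose j) * card (A {1..j}))"
      by (intro sum.cong refl) (simp add: n_subsets[of "{1..k}", simplified])
    also have "\<dots> = (\<Sum>j\<le>max k (card V). (k choose j) * card (A {1..j}))"
      by (intro sum.mono_neutral_left) auto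
    also have "\<dots> = (\<Sum>j\<le>card V. (k choose j) * card (A {1..j}))"
      by (intro sum.mono_neutral_right) (auto simp: A0 simp del: One_nat_def)
    finally show ?thesis
      by (simp add: p_def poly_sum b mult.commute)
  qed
  then show ?thesis unfolding is_chromatic_poly_def by blast
qed

lemma chromatic_poly_well_defined:
  assumes "hypergraph V E"
  shows "is_chromatic_poly V E (chromatic_poly V E)"
proof -
  obtain p where p: "is_chromatic_poly V E p"
    using is_chromatic_poly_exists[OF assms] by blast
  then show ?thesis
    unfolding chromatic_poly_def by (rule theI) (rule is_chromatic_poly_unique[OF _ p])
qed

end

theory Submission
  imports Defs
begin

text \<open>
  Induction on the number of edges, by deletion and contraction. Write \<open>H / e\<close> for the hypergraph in
  which the edge \<open>e\<close> is merged into one vertex. Then \<open>P(H) = P(H - e) - P(H / e)\<close>, and since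
  \<open>card e\<close> is even, the numbers of vertices of \<open>H\<close> and \<open>H / e\<close> have opposite parity, so both terms
  contribute with the same sign.

  Deleting an edge of size greater than 2 never leaves the class, and does not even change the
  polynomial if the edge contains an edge of size 2. Let \<open>e\<close> be an edge of size greater than 2 that
  contains no edge of size 2. If another edge \<open>f\<close> meets \<open>e\<close> in two vertices, then \<open>(e, f)\<close> is a
  cycle, so \<open>e \<union> f\<close> contains an edge of size 2; it survives in \<open>H / e\<close> inside the image of \<open>f\<close>,
  which may therefore be dropped. The remaining edges keep their size under merging, and every cycle
  of \<open>H / e\<close> lifts to a cycle of \<open>H\<close>, possibly through \<open>e\<close>. Once all edges have size 2, merging any
  edge again yields a graph.
\<close>

section \<open>Merging an edge into one vertex\<close>

text \<open>The merged vertex is represented by an old vertex \<open>w\<close> of \<open>e\<close>,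
  so a contraction keeps the vertex type and an induction can pass through it.\<close>

definition merge :: "'a set \<Rightarrow> 'a \<Rightarrow> 'a \<Rightarrow> 'a" where
  "merge e w x = (if x \<in> e then w else x)"

definition contract_verts :: "'a set \<Rightarrow> 'a set \<Rightarrow> 'a \<Rightarrow> 'a set" where
  "contract_verts V e w = insert w (V - e)"

text \<open>Merging shrinks an edge that meets \<open>e\<close> in two or more vertices and could
  make its size odd, so such edges are left out.\<close>

definition contract_edges :: "'a set set \<Rightarrow> 'a set \<Rightarrow> 'a \<Rightarrow> 'a set set" where
  "contract_edges E e w = (\<lambda>f. merge e w ` f) ` {f \<in> E - {e}. card (f \<inter> e) \<le> 1}"

lemma hypergraph_finite:
  assumes "hypergraph V E"
  shows "finite V" "finite E" "e \<in> E \<Longrightarrow> finite e"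
proof -
  show "finite V" using assms by (simp add: hypergraph_def)
  moreover have "E \<subseteq> Pow V" using assms by (auto simp: hypergraph_def)
  ultimately show "finite E" "e \<in> E \<Longrightarrow> finite e" by (auto intro: finite_subset)
qed

lemma hypergraph_subset: "hypergraph V E \<Longrightarrow> F \<subseteq> E \<Longrightarrow> hypergraph V F"
  by (auto simp: hypergraph_def)

section \<open>The class under deletion\<close>

text \<open>Any edge of a cycle is itself the required pair. This covers deletion and contraction
  once only a graph is left.\<close>

lemma in_L0_two_edges:
  assumes "\<And>e. e \<in> E \<Longrightarrow> card e = 2"
  shows "in_L0 V E"
  unfolding in_L0_def
proof (intro conjI ballI allI impI)
  show "even (card e)" if "e \<in> E" for e using assms[OF that] by simp
  fix vs es assume "hyper_cycle V E vs es"
  then obtain f where f: "f \<in> set es" "f \<in> E"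
    by (cases es) (auto simp: hyper_cycle_def)
  then obtain u v where "f = {u, v}" "u \<noteq> v" using assms by (metis card_2_iff)
  with f show "\<exists>u v. u \<noteq> v \<and> u \<in> \<Union>(set es) \<and> v \<in> \<Union>(set es) \<and> {u, v} \<in> E"
    by blast
qed

text \<open>A cycle avoiding \<open>e\<close> is a cycle of the whole hypergraph, and the pair found
  for it has size 2, hence is not \<open>e\<close>.\<close>

lemma in_L0_delete:
  assumes "in_L0 V E" "card e \<noteq> 2"
  shows "in_L0 V (E - {e})"
  unfolding in_L0_def
proof (intro conjI ballI allI impI)
  show "even (card f)" if "f \<in> E - {e}" for f using assms that by (auto simp: in_L0_def)
  fix vs es assume "hyper_cycle V (E - {e}) vs es"
  then have "hyper_cycle V E vs es" by (auto simp: hyper_cycle_def)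
  then obtain u v where uv: "u \<noteq> v" "u \<in> \<Union>(set es)" "v \<in> \<Union>(set es)" "{u, v} \<in> E"
    using assms unfolding in_L0_def by blast
  have "{u, v} \<noteq> e" using assms(2) uv(1) by auto
  with uv show "\<exists>u v. u \<noteq> v \<and> u \<in> \<Union>(set es) \<and> v \<in> \<Union>(set es) \<and> {u, v} \<in> E - {e}"
    by blast
qed

section \<open>Non-constant maps, and sizes in a contraction\<close>

lemma card_image_ge_2_iff:
  assumes "finite e" "w \<in> e"
  shows "card (f ` e) \<ge> 2 \<longleftrightarrow> (\<exists>x\<in>e. f x \<noteq> f w)"
proof
  assume c: "card (f ` e) \<ge> 2"
  show "\<exists>x\<in>e. f x \<noteq> f w"
  proof (rule ccontr)
    assume "\<not> ?thesis"
    then have "f ` e = {f w}" using assms(2) by blast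
    with c show False by simp
  qed
next
  assume "\<exists>x\<in>e. f x \<noteq> f w"
  then obtain x where "x \<in> e" "f x \<noteq> f w" by blast
  then have "card {f x, f w} \<le> card (f ` e)" using assms by (intro card_mono) auto
  with \<open>f x \<noteq> f w\<close> show "card (f ` e) \<ge> 2" by simp
qed

text \<open>Two vertices are identified only if both lie in \<open>e\<close>: as \<open>w\<close> is
  in \<open>e\<close>, no vertex outside \<open>e\<close> is sent to \<open>w\<close>.\<close>

lemma inj_on_merge:
  assumes "finite f" "card (f \<inter> e) \<le> 1" "w \<in> e"
  shows "inj_on (merge e w) f"
proof (rule inj_onI)
  fix x y assume xy: "x \<in> f" "y \<in> f" "merge e w x = merge e w y"
  have "x = y" if "x \<in> e" "y \<in> e"
    using that xy assms(1,2) card_le_Suc0_iff_eq[of "f \<inter> e"] by auto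
  with xy assms(3) show "x = y" by (auto simp: merge_def split: if_splits)
qed

lemma comp_merge_constant:
  assumes "\<forall>x\<in>e. f x = f w"
  shows "f (merge e w x) = f x"
proof (cases "x \<in> e")
  case True
  with assms have "f x = f w" by blast
  with True show ?thesis by (simp add: merge_def)
qed (simp add: merge_def)

lemma hypergraph_contract:
  assumes "hypergraph V E" "e \<in> E" "w \<in> e"
  shows "hypergraph (contract_verts V e w) (contract_edges E e w)"
  unfolding hypergraph_def
proof (intro conjI ballI)
  show "finite (contract_verts V e w)"
    using hypergraph_finite(1)[OF assms(1)] by (simp add: contract_verts_def)
  fix g assume "g \<in> contract_edges E e w"
  then obtain f where "f \<in> E" "g = merge e w ` f" by (auto simp: contract_edges_def)
  moreover have "f \<subseteq> V" "f \<noteq> {}" using assms(1) \<open>f \<in> E\<close> by (auto simp: hypergraph_def)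
  ultimately show "g \<subseteq> contract_verts V e w" "g \<noteq> {}"
    by (auto simp: merge_def contract_verts_def)
qed

text \<open>Merging is injective on every edge that is kept. Even size, and size 2, thus pass to the
  contraction.\<close>

lemma card_contract_edges:
  assumes "hypergraph V E" "f \<in> contract_edges E e w" "w \<in> e"
  shows "\<exists>g\<in>E. card f = card g"
proof -
  obtain g where g: "g \<in> E" "card (g \<inter> e) \<le> 1" "f = merge e w ` g"
    using assms(2) by (auto simp: contract_edges_def)
  then have "card f = card g"
    using assms by (simp add: inj_on_merge card_image hypergraph_finite(3))
  with g(1) show ?thesis by blast
qed

text \<open>At least \<open>e\<close> itself is lost, which makes the induction apply; edges that
  coincide after merging only lower the count further.\<close>

lemma card_contract_edges_less:
  assumes "finite E" "e \<in> E"
  shows "card (contract_edges E e w) < card E"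
proof -
  have "card (contract_edges E e w) \<le> card {f \<in> E - {e}. card (f \<inter> e) \<le> 1}"
    unfolding contract_edges_def using assms by (intro card_image_le) auto
  also have "\<dots> \<le> card (E - {e})" using assms by (intro card_mono) auto
  also have "\<dots> < card E" using assms by (rule card_Diff1_less)
  finally show ?thesis .
qed

lemma card_contract_verts:
  assumes "finite V" "e \<subseteq> V" "w \<in> e"
  shows "card (contract_verts V e w) + card e = card V + 1"
proof -
  have "finite e" using assms finite_subset by blast
  then have "card (V - e) = card V - card e" "card e \<le> card V"
    using assms by (auto simp: card_Diff_subset card_mono)
  then show ?thesis using assms by (simp add: contract_verts_def)
qed

section \<open>Deletion and contraction for the chromatic polynomial\<close>

lemma chromatic_polyI:
  assumes "is_chromatic_poly V E p"
  shows "chromatic_poly V E = p"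
  unfolding chromatic_poly_def
  by (rule the_equality) (use assms is_chromatic_poly_unique in blast)+

lemma finite_weak_proper_colorings: "finite V \<Longrightarrow> finite (weak_proper_colorings V E k)"
  by (simp add: weak_proper_colorings_def finite_PiE)

lemma chromatic_poly_no_edges:
  assumes "finite V"
  shows "chromatic_poly V {} = monom 1 (card V)"
  by (rule chromatic_polyI)
    (simp add: is_chromatic_poly_def weak_proper_colorings_def card_PiE assms poly_monom)

text \<open>A coloring with two colors on \<open>g\<close> has two colors on \<open>e\<close>, so
  the condition for \<open>e\<close> is redundant.\<close>

lemma chromatic_poly_delete_superset:
  assumes "hypergraph V E" "e \<in> E" "g \<in> E" "g \<subset> e"
  shows "chromatic_poly V E = chromatic_poly V (E - {e})"
proof -
  have "card (\<phi> ` e) \<ge> 2" if "card (\<phi> ` g) \<ge> 2" for \<phi> :: "'a \<Rightarrow> nat"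
  proof -
    have "card (\<phi> ` g) \<le> card (\<phi> ` e)"
      using assms hypergraph_finite(3)[OF assms(1,2)] by (intro card_mono image_mono) auto
    with that show ?thesis by simp
  qed
  then have "weak_proper_colorings V E k = weak_proper_colorings V (E - {e}) k" for k
    using assms by (auto simp: weak_proper_colorings_def)
  then show ?thesis by (simp add: chromatic_poly_def is_chromatic_poly_def)
qed

text \<open>A coloring constant on \<open>e\<close> factors through the merge. Restriction to the
  contracted vertex set and composition with \<open>merge e w\<close> are mutually inverse;
  \<open>dropped\<close> restores the conditions for the edges left out.\<close>

lemma card_colorings_constant_on_edge:
  assumes H: "hypergraph V E" and e: "e \<in> E" and w: "w \<in> e"
    and dropped: "\<And>f. f \<in> E \<Longrightarrow> f \<noteq> e \<Longrightarrow> card (f \<inter> e) \<ge> 2 \<Longrightarrow>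
      \<exists>g\<in>contract_edges E e w. g \<subseteq> merge e w ` f"
  shows "card {\<phi> \<in> weak_proper_colorings V (E - {e}) k. \<forall>x\<in>e. \<phi> x = \<phi> w}
    = card (weak_proper_colorings (contract_verts V e w) (contract_edges E e w) k)"
    (is "card ?A = card ?B")
proof -
  let ?V = "contract_verts V e w"
  let ?r = "\<lambda>\<phi>. restrict \<phi> ?V" and ?l = "\<lambda>\<psi>. restrict (\<psi> \<circ> merge e w) V"
  have eV: "e \<subseteq> V" and VV: "?V \<subseteq> V"
    using H e w by (auto simp: hypergraph_def contract_verts_def)
  have EV: "f \<subseteq> V" "finite f" if "f \<in> E" for f
    using H that hypergraph_finite(3)[OF H that] by (auto simp: hypergraph_def)
  have mV: "merge e w x \<in> ?V" if "x \<in> V" for x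
    using that by (auto simp: merge_def contract_verts_def)
  have mid: "merge e w x = x" if "x \<in> ?V" for x
    using that by (auto simp: merge_def contract_verts_def)
  have "bij_betw ?r ?A ?B"
  proof (rule bij_betw_byWitness[where f' = ?l])
    show "\<forall>\<phi>\<in>?A. ?l (?r \<phi>) = \<phi>"
    proof
      fix \<phi> assume a: "\<phi> \<in> ?A"
      show "?l (?r \<phi>) = \<phi>"
      proof
        fix x
        have "\<phi> (merge e w x) = \<phi> x" using a by (intro comp_merge_constant) blast
        \<comment> \<open>Colorings are extensional, so equality must also hold off
          \<open>V\<close>, where both sides are \<open>undefined\<close>.\<close>
        moreover have "\<phi> x = undefined" if "x \<notin> V"
          using a that PiE_arb unfolding weak_proper_colorings_def by fast
        ultimately show "?l (?r \<phi>) x = \<phi> x" using mV[of x] by auto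
      qed
    qed
    show "\<forall>\<psi>\<in>?B. ?r (?l \<psi>) = \<psi>"
    proof
      fix \<psi> assume b: "\<psi> \<in> ?B"
      show "?r (?l \<psi>) = \<psi>"
      proof
        fix x
        have "\<psi> x = undefined" if "x \<notin> ?V"
          using b that PiE_arb unfolding weak_proper_colorings_def by fast
        then show "?r (?l \<psi>) x = \<psi> x" using mid[of x] VV by (cases "x \<in> ?V") auto
      qed
    qed
    show "?r ` ?A \<subseteq> ?B"
    proof clarify
      fix \<phi> assume a: "\<phi> \<in> weak_proper_colorings V (E - {e}) k" "\<forall>x\<in>e. \<phi> x = \<phi> w"
      have "card (?r \<phi> ` g) \<ge> 2" if g: "g \<in> contract_edges E e w" for g
      proof -
        obtain f where f: "f \<in> E - {e}" "g = merge e w ` f"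
          using g by (auto simp: contract_edges_def)
        have "?r \<phi> (merge e w x) = \<phi> x" if "x \<in> f" for x
        proof -
          have "x \<in> V" using that f EV(1) by blast
          moreover have "\<phi> (merge e w x) = \<phi> x" using a(2) by (rule comp_merge_constant)
          ultimately show ?thesis using mV by simp
        qed
        then have "?r \<phi> ` g = \<phi> ` f" unfolding f(2) image_image by simp
        with a(1) f show ?thesis by (simp add: weak_proper_colorings_def)
      qed
      moreover have "?r \<phi> \<in> ?V \<rightarrow>\<^sub>E {1..k}"
        using a(1) VV by (auto simp: weak_proper_colorings_def)
      ultimately show "?r \<phi> \<in> ?B" by (simp add: weak_proper_colorings_def)
    qed
    show "?l ` ?B \<subseteq> ?A"
    proof clarify
      fix \<psi> assume b: "\<psi> \<in> ?B"
      have im: "?l \<psi> ` f = \<psi> ` merge e w ` f" if "f \<in> E" for f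
        using EV[OF that] by (auto simp: image_image intro!: image_cong)
      have "card (?l \<psi> ` f) \<ge> 2" if f: "f \<in> E - {e}" for f
      proof (cases "card (f \<inter> e) \<le> 1")
        case True
        then have "merge e w ` f \<in> contract_edges E e w" using f by (auto simp: contract_edges_def)
        with b im f show ?thesis by (auto simp: weak_proper_colorings_def)
      next
        case False
        then obtain g where g: "g \<in> contract_edges E e w" "g \<subseteq> merge e w ` f"
          using dropped[of f] f by auto
        have "2 \<le> card (\<psi> ` g)" using b g by (auto simp: weak_proper_colorings_def)
        also have "\<dots> \<le> card (\<psi> ` merge e w ` f)"
          using g EV f by (intro card_mono image_mono) auto
        finally show ?thesis using im f by simp
      qed
      moreover have "?l \<psi> \<in> V \<rightarrow>\<^sub>E {1..k}"
        using b mV by (auto simp: weak_proper_colorings_def PiE_iff)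
      moreover have "\<forall>x\<in>e. ?l \<psi> x = ?l \<psi> w"
        using eV w by (auto simp: merge_def)
      ultimately show "?l \<psi> \<in> weak_proper_colorings V (E - {e}) k \<and> (\<forall>x\<in>e. ?l \<psi> x = ?l \<psi> w)"
        unfolding weak_proper_colorings_def by blast
    qed
  qed
  then show ?thesis by (rule bij_betw_same_card)
qed

text \<open>The colorings of \<open>E - {e}\<close> split into those not constant on
  \<open>e\<close>, which color \<open>E\<close>, and those constant on \<open>e\<close>, which
  color the contraction.\<close>

lemma chromatic_poly_delete_contract:
  assumes H: "hypergraph V E" and e: "e \<in> E" and w: "w \<in> e"
    and dropped: "\<And>f. f \<in> E \<Longrightarrow> f \<noteq> e \<Longrightarrow> card (f \<inter> e) \<ge> 2 \<Longrightarrow>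
      \<exists>g\<in>contract_edges E e w. g \<subseteq> merge e w ` f"
  shows "chromatic_poly V E = chromatic_poly V (E - {e})
    - chromatic_poly (contract_verts V e w) (contract_edges E e w)"
proof (rule chromatic_polyI)
  let ?q = "chromatic_poly V (E - {e})"
  let ?r = "chromatic_poly (contract_verts V e w) (contract_edges E e w)"
  have q: "is_chromatic_poly V (E - {e}) ?q"
    by (rule chromatic_poly_well_defined) (use H hypergraph_subset in blast)
  have r: "is_chromatic_poly (contract_verts V e w) (contract_edges E e w) ?r"
    by (rule chromatic_poly_well_defined) (rule hypergraph_contract[OF H e w])
  have "card (weak_proper_colorings V (E - {e}) k) = card (weak_proper_colorings V E k)
    + card (weak_proper_colorings (contract_verts V e w) (contract_edges E e w) k)" for k
  proof -
    let ?C = "{\<phi> \<in> weak_proper_colorings V (E - {e}) k. \<forall>x\<in>e. \<phi> x = \<phi> w}"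
    have "card (\<phi> ` e) \<ge> 2 \<longleftrightarrow> \<not> (\<forall>x\<in>e. \<phi> x = \<phi> w)" for \<phi> :: "'a \<Rightarrow> nat"
      using card_image_ge_2_iff[of e w \<phi>] w hypergraph_finite(3)[OF H e] by blast
    then have E: "weak_proper_colorings V E k = weak_proper_colorings V (E - {e}) k - ?C"
      using e unfolding weak_proper_colorings_def by blast
    have fin: "finite (weak_proper_colorings V (E - {e}) k)"
      using hypergraph_finite(1)[OF H] by (rule finite_weak_proper_colorings)
    then have "card (weak_proper_colorings V E k)
        = card (weak_proper_colorings V (E - {e}) k) - card ?C"
      unfolding E by (intro card_Diff_subset) auto
    moreover have "card ?C \<le> card (weak_proper_colorings V (E - {e}) k)"
      using fin by (intro card_mono) auto
    ultimately show ?thesis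
      using card_colorings_constant_on_edge[OF H e w dropped, of k] by simp
  qed
  with q r show "is_chromatic_poly V E (?q - ?r)"
    by (simp add: is_chromatic_poly_def)
qed

section \<open>Lifting cycles out of a contraction\<close>

lemma hyper_cycle_rotate:
  assumes "hyper_cycle V E vs es"
  shows "hyper_cycle V E (rotate n vs) (rotate n es)"
proof -
  let ?l = "length es"
  have l: "length vs = ?l" "?l \<ge> 2" using assms by (auto simp: hyper_cycle_def)
  have "{rotate n vs ! i, rotate n vs ! (Suc i mod ?l)} \<subseteq> rotate n es ! i" if i: "i < ?l" for i
  proof -
    have j: "m mod ?l < ?l" for m using l by (intro mod_less_divisor) linarith
    have "{vs ! ((n + i) mod ?l), vs ! (Suc ((n + i) mod ?l) mod ?l)} \<subseteq> es ! ((n + i) mod ?l)"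
      using assms l(1) j unfolding hyper_cycle_def by metis
    moreover have "Suc i mod ?l < ?l" by (rule j)
    moreover have "(n + Suc i mod ?l) mod ?l = Suc ((n + i) mod ?l) mod ?l"
      by (simp add: mod_simps)
    ultimately show ?thesis using i l(1) nth_rotate[of _ vs n] nth_rotate[of _ es n] by simp
  qed
  with assms show ?thesis by (simp add: hyper_cycle_def)
qed

text \<open>Replace each edge by a preimage. This can fail to close up only at \<open>w\<close>, and
  there \<open>e\<close> bridges the gap. The bound on the merged union lets a pair found in the
  lifted cycle be pushed back down.\<close>

lemma hyper_cycle_lift:
  assumes H: "hypergraph V E" and e: "e \<in> E" and w: "w \<in> e"
    and cyc: "hyper_cycle (contract_verts V e w) (contract_edges E e w) vs es"
  obtains vs' es' where "hyper_cycle V E vs' es'" "merge e w ` \<Union>(set es') \<subseteq> \<Union>(set es)"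
proof -
  let ?V = "contract_verts V e w" and ?E = "contract_edges E e w"
  have VV: "?V \<subseteq> V" "e \<subseteq> V" using H e w by (auto simp: hypergraph_def contract_verts_def)
  have "\<exists>g. g \<in> E - {e} \<and> f = merge e w ` g" if "f \<in> ?E" for f
    using that by (auto simp: contract_edges_def)
  \<comment> \<open>The merge recovers \<open>f\<close> from \<open>L f\<close>, so \<open>L\<close>
    is injective on the contracted edges and lifted edges stay distinct; none of them is
    \<open>e\<close>.\<close>
  then obtain L where L: "\<And>f. f \<in> ?E \<Longrightarrow> L f \<in> E - {e}" "\<And>f. f \<in> ?E \<Longrightarrow> f = merge e w ` L f"
    by metis
  \<comment> \<open>Only \<open>w\<close> can have a preimage other than itself.\<close>
  have inL: "x \<in> L f" if "f \<in> ?E" "x \<in> f" "x \<noteq> w" for f x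
    using that L(2)[of f] by (auto simp: merge_def split: if_splits)
  have wL: "\<exists>u\<in>e. u \<in> L f" if "f \<in> ?E" "w \<in> f" for f
    using that L(2)[of f] w by (auto simp: merge_def split: if_splits)
  show ?thesis
  proof (cases "w \<in> set vs")
    case False
    have "hyper_cycle V E vs (map L es)"
      unfolding hyper_cycle_def
    proof (intro conjI allI impI)
      have esE: "set es \<subseteq> ?E" using cyc by (simp add: hyper_cycle_def)
      show "2 \<le> length (map L es)" "length vs = length (map L es)" "distinct vs"
        using cyc by (simp_all add: hyper_cycle_def)
      show "set vs \<subseteq> V" using cyc VV by (auto simp: hyper_cycle_def)
      show "distinct (map L es)"
        using cyc esE L(2) by (auto simp: hyper_cycle_def distinct_map inj_on_def) (metis subsetD)+
      show "set (map L es) \<subseteq> E" using esE L(1) by auto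
      fix i assume i: "i < length (map L es)"
      then have "Suc i mod length vs < length vs" "i < length vs"
        using cyc by (auto simp: hyper_cycle_def intro: mod_less_divisor)
      then have "vs ! i \<noteq> w" "vs ! (Suc i mod length vs) \<noteq> w" using False by (metis nth_mem)+
      moreover have "{vs ! i, vs ! (Suc i mod length vs)} \<subseteq> es ! i" "es ! i \<in> ?E"
        using cyc i esE by (auto simp: hyper_cycle_def)
      ultimately show "{vs ! i, vs ! (Suc i mod length vs)} \<subseteq> map L es ! i"
        using i inL by auto
    qed
    moreover have "merge e w ` \<Union>(set (map L es)) \<subseteq> \<Union>(set es)"
      using cyc L(2) by (fastforce simp: hyper_cycle_def)
    ultimately show ?thesis by (rule that)
  next
    case True
    then obtain n where n: "n < length vs" "vs ! n = w" by (auto simp: in_set_conv_nth)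
    \<comment> \<open>Rotating puts \<open>w\<close> first, so that the edges at \<open>w\<close>
      are the first and the last.\<close>
    define us fs where "us = rotate n vs" and "fs = rotate n es"
    have c: "hyper_cycle ?V ?E us fs" unfolding us_def fs_def by (rule hyper_cycle_rotate[OF cyc])
    have set_fs: "set fs = set es" by (simp add: fs_def)
    have "0 < length vs" using n(1) by linarith
    then have us0: "us ! 0 = w" using n nth_rotate[of 0 vs n] by (simp add: us_def)
    let ?l = "length fs"
    have l: "?l \<ge> 2" "length us = ?l" using c by (auto simp: hyper_cycle_def)
    then obtain xs where us: "us = w # xs" using us0 by (cases us) auto
    have xs: "distinct xs" "w \<notin> set xs" "set xs \<subseteq> V - e" "length xs = ?l - 1"
      using c us l by (auto simp: hyper_cycle_def contract_verts_def)
    have fsE: "set fs \<subseteq> ?E" and dfs: "distinct fs" using c by (auto simp: hyper_cycle_def)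
    have step: "{us ! i, us ! (Suc i mod ?l)} \<subseteq> fs ! i" if "i < ?l" for i
      using c that l unfolding hyper_cycle_def by metis
    have fs_nth: "fs ! i \<in> ?E" if "i < ?l" for i using that fsE by auto
    have dL: "distinct (map L fs)"
      using dfs fsE L(2) by (auto simp: distinct_map inj_on_def) (metis subsetD)+
    have lpos: "0 < ?l" "?l - 1 < ?l" using l by linarith+
    have wfs: "w \<in> fs ! 0" "w \<in> fs ! (?l - 1)"
    proof -
      have "Suc (?l - 1) = ?l" using l by linarith
      then have "Suc (?l - 1) mod ?l = 0" by simp
      with lpos step[of 0] step[of "?l - 1"] us0 show "w \<in> fs ! 0" "w \<in> fs ! (?l - 1)" by auto
    qed
    \<comment> \<open>The lifts of the two edges at \<open>w\<close> both meet \<open>e\<close>, but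
      perhaps in different vertices; \<open>a\<close> and \<open>b\<close> record where.\<close>
    obtain a where a: "a \<in> e" "a \<in> L (fs ! 0)" using wL[OF fs_nth[OF lpos(1)] wfs(1)] by blast
    obtain b where b: "b \<in> e" "b \<in> L (fs ! (?l - 1))" using wL[OF fs_nth[OF lpos(2)] wfs(2)] by blast
    \<comment> \<open>The index shifts by one because \<open>us = w # xs\<close>: vertex
      \<open>i\<close> of the cycle is entry \<open>i - 1\<close> of \<open>xs\<close>.\<close>
    have xsL1: "xs ! (i - 1) \<in> L (fs ! i)" if "0 < i" "i < ?l" for i
    proof -
      have "xs ! (i - 1) \<in> set xs" using that xs(4) by (intro nth_mem) auto
      moreover have "xs ! (i - 1) \<in> fs ! i" using step[of i] that us by (cases i) auto
      ultimately show ?thesis using inL[OF fs_nth[OF that(2)]] xs(2) by metis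
    qed
    have xsL2: "xs ! i \<in> L (fs ! i)" if "Suc i < ?l" for i
    proof -
      have "xs ! i \<in> set xs" using that xs(4) by (intro nth_mem) auto
      moreover have "xs ! i \<in> fs ! i" using step[of i] that us by auto
      ultimately show ?thesis using inL[OF fs_nth] that xs(2) by (metis Suc_lessD)
    qed
    have merge_L: "merge e w ` L f \<subseteq> \<Union>(set es)" if "f \<in> set es" for f
      using L(2)[of f] that fsE set_fs by auto
    show ?thesis
    proof (cases "a = b")
      case True
      \<comment> \<open>The two lifts share \<open>a\<close>, which takes the place of
        \<open>w\<close>.\<close>
      have "hyper_cycle V E (a # xs) (map L fs)"
        unfolding hyper_cycle_def
      proof (intro conjI allI impI)
        show "2 \<le> length (map L fs)" "length (a # xs) = length (map L fs)"
          using l xs(4) by auto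
        show "distinct (a # xs)" "set (a # xs) \<subseteq> V" using xs a VV by auto
        show "distinct (map L fs)" by (rule dL)
        show "set (map L fs) \<subseteq> E" using fsE L(1) by auto
        fix i assume i: "i < length (map L fs)"
        have "(a # xs) ! i \<in> L (fs ! i)"
          using a xsL1[of i] i by (cases i) auto
        moreover have "(a # xs) ! (Suc i mod ?l) \<in> L (fs ! i)"
        proof (cases "Suc i < ?l")
          case True
          then show ?thesis using xsL2[of i] by simp
        next
          case False
          then have "Suc i = ?l" using i by simp
          then show ?thesis using b \<open>a = b\<close> by (metis diff_Suc_1 mod_self nth_Cons_0)
        qed
        moreover have "length (a # xs) = ?l" using xs(4) lpos(1) by simp
        ultimately show "{(a # xs) ! i, (a # xs) ! (Suc i mod length (a # xs))} \<subseteq> map L fs ! i"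
          using i by (simp del: list.size)
      qed
      moreover have "merge e w ` \<Union>(set (map L fs)) \<subseteq> \<Union>(set es)"
        using merge_L set_fs by fastforce
      ultimately show ?thesis by (rule that)
    next
      case False
      \<comment> \<open>Here \<open>w\<close> splits into \<open>a\<close> and \<open>b\<close>, and
        \<open>e\<close> leads from \<open>b\<close> back to \<open>a\<close>.\<close>
      let ?us = "a # xs @ [b]" and ?fs = "map L fs @ [e]"
      have "hyper_cycle V E ?us ?fs"
        unfolding hyper_cycle_def
      proof (intro conjI allI impI)
        show "2 \<le> length ?fs" "length ?us = length ?fs" using l xs(4) by auto
        show "distinct ?us" "set ?us \<subseteq> V" using xs a b VV False by auto
        show "distinct ?fs" using dL fsE L(1) by auto
        show "set ?fs \<subseteq> E" using fsE L(1) e by auto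
        fix i assume i: "i < length ?fs"
        show "{?us ! i, ?us ! (Suc i mod length ?us)} \<subseteq> ?fs ! i"
        proof (cases "i < ?l")
          case True
          have "?us ! i \<in> L (fs ! i)"
            using a xsL1[of i] True xs(4) by (cases i) (auto simp: nth_append)
          moreover have "?us ! Suc i \<in> L (fs ! i)"
          proof (cases "Suc i < ?l")
            case True
            then show ?thesis using xsL2[of i] xs(4) by (auto simp: nth_append)
          next
            case False
            then have "i = ?l - 1" using True by simp
            then show ?thesis using b xs(4) by (simp add: nth_append)
          qed
          ultimately show ?thesis using True xs(4) l by (simp add: nth_append)
        next
          case False
          then have "i = ?l" using i by simp
          then show ?thesis using a b xs(4) l by (auto simp: nth_append nth_Cons')
        qed
      qed
      moreover have "merge e w ` \<Union>(set ?fs) \<subseteq> \<Union>(set es)"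
      proof -
        \<comment> \<open>The added edge \<open>e\<close> merges to \<open>w\<close> alone, which
          the first edge of the cycle contains.\<close>
        have "fs ! 0 \<in> set es" using l set_fs by (metis nth_mem less_le_trans pos2)
        then have "merge e w ` e \<subseteq> \<Union>(set es)" using wfs(1) by (auto simp: merge_def)
        with merge_L set_fs show ?thesis by fastforce
      qed
      ultimately show ?thesis by (rule that)
    qed
  qed
qed

section \<open>The class under contraction\<close>

text \<open>A pair not inside \<open>e\<close> has at most one vertex in \<open>e\<close>, so it is
  neither left out nor collapsed.\<close>

lemma merge_two_edge:
  assumes "{u, v} \<in> E" "u \<noteq> v" "w \<in> e" "\<not> {u, v} \<subseteq> e" "card e \<noteq> 2"
  shows "{merge e w u, merge e w v} \<in> contract_edges E e w" "merge e w u \<noteq> merge e w v"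
proof -
  have "{u, v} \<inter> e \<subseteq> {u} \<or> {u, v} \<inter> e \<subseteq> {v}" using assms(4) by auto
  then have "card ({u, v} \<inter> e) \<le> 1"
    by (metis card_mono finite.emptyI finite_insert is_singletonI is_singleton_altdef)
  moreover have "{u, v} \<noteq> e" using assms by auto
  ultimately have "merge e w ` {u, v} \<in> contract_edges E e w"
    unfolding contract_edges_def using assms(1) by (intro imageI) simp
  then show "{merge e w u, merge e w v} \<in> contract_edges E e w" by simp
  show "merge e w u \<noteq> merge e w v" using assms by (auto simp: merge_def)
qed

text \<open>Lift the cycle, take the pair that the class provides for the lift, and merge it; by
  \<open>minimal\<close> the pair survives.\<close>

lemma in_L0_contract:
  assumes H: "hypergraph V E" and L0: "in_L0 V E" and e: "e \<in> E" "card e \<noteq> 2" and w: "w \<in> e"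
    and minimal: "\<And>u v. {u, v} \<in> E \<Longrightarrow> u \<noteq> v \<Longrightarrow> \<not> {u, v} \<subseteq> e"
  shows "in_L0 (contract_verts V e w) (contract_edges E e w)"
  unfolding in_L0_def
proof (intro conjI ballI allI impI)
  show "even (card f)" if "f \<in> contract_edges E e w" for f
    using card_contract_edges[OF H that w] L0 by (auto simp: in_L0_def)
  fix vs es assume "hyper_cycle (contract_verts V e w) (contract_edges E e w) vs es"
  then obtain vs' es' where c: "hyper_cycle V E vs' es'" "merge e w ` \<Union>(set es') \<subseteq> \<Union>(set es)"
    using hyper_cycle_lift[OF H e(1) w] by metis
  then obtain u v where uv: "u \<noteq> v" "u \<in> \<Union>(set es')" "v \<in> \<Union>(set es')" "{u, v} \<in> E"
    using L0 unfolding in_L0_def by blast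
  note m = merge_two_edge[OF uv(4,1) w minimal[OF uv(4,1)] e(2)]
  have "merge e w u \<in> \<Union>(set es)" "merge e w v \<in> \<Union>(set es)" using c(2) uv by blast+
  with m show "\<exists>u v. u \<noteq> v \<and> u \<in> \<Union>(set es) \<and> v \<in> \<Union>(set es) \<and> {u, v} \<in> contract_edges E e w"
    by blast
qed

lemma contract_edges_dropped:
  assumes H: "hypergraph V E" and L0: "in_L0 V E" and e: "e \<in> E" "card e \<noteq> 2" and w: "w \<in> e"
    and minimal: "\<And>u v. {u, v} \<in> E \<Longrightarrow> u \<noteq> v \<Longrightarrow> \<not> {u, v} \<subseteq> e"
    and f: "f \<in> E" "f \<noteq> e" "card (f \<inter> e) \<ge> 2"
  shows "\<exists>g\<in>contract_edges E e w. g \<subseteq> merge e w ` f"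
proof -
  obtain a b where ab: "a \<noteq> b" "{a, b} \<subseteq> f \<inter> e"
    using obtain_subset_with_card_n[OF f(3)] by (metis card_2_iff)
  \<comment> \<open>Two common vertices make a cycle of length 2.\<close>
  have "hyper_cycle V E [a, b] [e, f]"
    using H e(1) f ab by (auto simp: hyper_cycle_def hypergraph_def less_Suc_eq)
  then obtain u v where uv: "u \<noteq> v" "u \<in> e \<union> f" "v \<in> e \<union> f" "{u, v} \<in> E"
    using L0 unfolding in_L0_def by (metis Union_insert Sup_empty Un_empty_right list.set)
  \<comment> \<open>All of \<open>e\<close> goes to \<open>w\<close>, and so does the common vertex
    \<open>a\<close> of \<open>f\<close>.\<close>
  have "merge e w x \<in> merge e w ` f" if "x \<in> e \<union> f" for x
    using that ab by (auto simp: merge_def image_iff)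
  then have "{merge e w u, merge e w v} \<subseteq> merge e w ` f" using uv by simp
  with merge_two_edge(1)[OF uv(4,1) w minimal[OF uv(4,1)] e(2)] show ?thesis by (rule bexI[rotated])
qed

section \<open>Induction on the number of edges\<close>

lemma poly_chromatic_poly_sign:
  assumes "hypergraph V E" "in_L0 V E" and x: "(x::real) < 0"
  shows "(-1) ^ card V * poly (chromatic_poly V E) x > 0"
  using assms(1,2)
proof (induction "card E" arbitrary: V E rule: less_induct)
  case less
  note H = \<open>hypergraph V E\<close> and L0 = \<open>in_L0 V E\<close>
  note fin = hypergraph_finite[OF H]
  have delete: "(-1) ^ card V * poly (chromatic_poly V (E - {e})) x > 0"
    if "e \<in> E" "in_L0 V (E - {e})" for e
    using less.hyps[OF card_Diff1_less[OF fin(2) that(1)] hypergraph_subset[OF H] that(2)] by blast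
  \<comment> \<open>Shared by the cases that contract: the minus sign of the recurrence cancels
    against the parity change of the vertex count.\<close>
  have contract: ?case
    if e: "e \<in> E" and w: "w \<in> e" and del: "in_L0 V (E - {e})"
      and con: "in_L0 (contract_verts V e w) (contract_edges E e w)"
      and dropped: "\<And>f. f \<in> E \<Longrightarrow> f \<noteq> e \<Longrightarrow> card (f \<inter> e) \<ge> 2 \<Longrightarrow>
        \<exists>g\<in>contract_edges E e w. g \<subseteq> merge e w ` f"
    for e w
  proof -
    let ?V = "contract_verts V e w"
    let ?q = "poly (chromatic_poly V (E - {e})) x"
    let ?r = "poly (chromatic_poly ?V (contract_edges E e w)) x"
    have r: "(-1) ^ card ?V * ?r > 0"
      using less.hyps[OF card_contract_edges_less hypergraph_contract] e fin H w con by blast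
    have "even (card e)" using L0 e by (simp add: in_L0_def)
    moreover have "card ?V + card e = card V + 1"
      using card_contract_verts[OF fin(1) _ w] H e by (simp add: hypergraph_def)
    ultimately have "even (card ?V) \<longleftrightarrow> odd (card V)" by presburger
    then have "(-1 :: real) ^ card ?V = - ((-1) ^ card V)"
      by (cases "even (card V)") simp_all
    then have "(-1) ^ card V * poly (chromatic_poly V E) x
        = (-1) ^ card V * ?q + (-1) ^ card ?V * ?r"
      using chromatic_poly_delete_contract[OF H e w dropped] by (simp add: right_diff_distrib)
    with r delete[OF e del] show ?thesis by simp
  qed
  \<comment> \<open>Edges are nonempty and even, so \<open>card e \<noteq> 2\<close> means larger.
    Such edges go first: deleting a pair may destroy what some cycle needs, unless all edges are
    pairs.\<close>
  consider "E = {}" | e where "e \<in> E" "card e \<noteq> 2" | e where "e \<in> E" "\<forall>f\<in>E. card f = 2"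
    by blast
  then show ?case
  proof cases
    case 1
    have "(-1) ^ card V * x ^ card V = (- x) ^ card V"
      by (simp flip: power_mult_distrib)
    with 1 fin x show ?thesis by (simp add: chromatic_poly_no_edges poly_monom)
  next
    case (2 e)
    have del: "in_L0 V (E - {e})" by (rule in_L0_delete[OF L0 2(2)])
    show ?thesis
    proof (cases "\<exists>u v. {u, v} \<in> E \<and> u \<noteq> v \<and> {u, v} \<subseteq> e")
      case True
      then obtain u v where uv: "{u, v} \<in> E" "u \<noteq> v" "{u, v} \<subseteq> e" by blast
      then have "{u, v} \<subset> e" using 2(2) by (auto simp: psubset_eq)
      then show ?thesis
        using chromatic_poly_delete_superset[OF H 2(1) uv(1)] delete[OF 2(1) del] by simp
    next
      case False
      then have minimal: "\<And>u v. {u, v} \<in> E \<Longrightarrow> u \<noteq> v \<Longrightarrow> \<not> {u, v} \<subseteq> e" by blast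
      obtain w where w: "w \<in> e" using H 2(1) by (auto simp: hypergraph_def)
      show ?thesis
        using contract[OF 2(1) w del in_L0_contract[OF H L0 2 w minimal]
            contract_edges_dropped[OF H L0 2 w minimal]] by blast
    qed
  next
    case (3 e)
    obtain w where w: "w \<in> e" using H 3(1) by (auto simp: hypergraph_def)
    \<comment> \<open>Distinct edges of size 2 share at most one vertex, so no edge other than
      \<open>e\<close> is left out.\<close>
    have False if f: "f \<in> E" "f \<noteq> e" "card (f \<inter> e) \<ge> 2" for f
    proof -
      have "f \<inter> e = f" by (rule card_seteq) (use 3 f fin in auto)
      moreover have "f \<inter> e = e" by (rule card_seteq) (use 3 f fin in auto)
      ultimately have "f = e" by blast
      with f(2) show False by simp
    qed
    moreover have "in_L0 (contract_verts V e w) (contract_edges E e w)"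
      using card_contract_edges[OF H _ w] 3(2) by (intro in_L0_two_edges) metis
    moreover have "in_L0 V (E - {e})" using 3(2) by (intro in_L0_two_edges) auto
    ultimately show ?thesis using contract[OF 3(1) w] by blast
  qed
qed

theorem theorem1p2:
  fixes V :: "'a set" and E :: "'a set set"
  assumes "hypergraph V E"
    and "in_L0 V E"
  shows "\<forall>x::real. x < 0 \<longrightarrow> (-1) ^ card V * poly (chromatic_poly V E) x > 0"
  using poly_chromatic_poly_sign[OF assms] by blast

end
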